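(* Let $f:\mathbb R^d\times\mathbb R^M\to\mathbb R$ be a model that is real-analytic in $(x,\theta)$. If $f^*\in\mathcal F$ has $n$-sample LLR-guarantee, then $f^*$ has $n$-sample LLR-guarantee almost everywhere: for Lebesgue-almost every $X=[x_1,\dots,x_n]\in\mathbb R^{d\times n}$, $f^*$ has LLR-guarantee from $S=\{(x_i,f^*(x_i))\}_{i=1}^n$.
   Context: A model is a map $f:\mathbb R^d\times\mathbb R^M\to\mathbb R$, $(x,\theta)\mapsto f(x;\theta)=f_\theta(x)$; its function space is $\mathcal F=\{f_\theta:\theta\in\mathbb R^M\}$. The loss $\ell:\mathbb R\times\mathbb R\to[0,\infty)$ is continuously differentiable with $\ell(u,v)=0$ iff $u=v$. For $f^*\in\mathcal F$, the target set is $\mathcal M_{f^*}=\{\theta: f_\theta=f^*\}$. A dataset from $f^*$ of size $n$ is $S=\{(x_i,f^*(x_i))\}_{i=1}^n$; the empirical loss of $g:\mathbb R^d\to\mathbb R$ is $\frac1n\sum_{i=1}^n\ell(g(x_i),f^*(x_i))$ (identically $0$ if $n=0$). The tangent function hyperplane at $\theta'$ is $\widetilde{\mathcal T}_{\theta'}=\{f(\cdot;\theta')+a^\top\nabla_\theta f(\cdot;\theta'):a\in\mathbb R^M\}$. $f^*$ has LLR-guarantee from $S$ if there exists $\theta'\in\mathcal M_{f^*}$ such that the set of minimizers of the empirical loss over $\widetilde{\mathcal T}_{\theta'}$ is exactly $\{f^*\}$; $f^*$ has $n$-sample LLR-guarantee if it has LLR-guarantee from some dataset from $f^*$ of size $n$.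 *)

theory Defs
  imports "HOL-Analysis.Analysis"
begin

definition real_analytic :: "(real ^ 'k \<Rightarrow> real) \<Rightarrow> bool" where
  "real_analytic g \<longleftrightarrow>
     (\<forall>p. \<exists>r>0. \<exists>c :: ('k \<Rightarrow> nat) \<Rightarrow> real.
        \<forall>z \<in> ball p r.
          ((\<lambda>\<alpha>. c \<alpha> * (\<Prod>i\<in>UNIV. (z $ i - p $ i) ^ \<alpha> i)) has_sum g z) UNIV)"

definition model_real_analytic :: "(real ^ 'd \<Rightarrow> real ^ 'm \<Rightarrow> real) \<Rightarrow> bool" where
  "model_real_analytic f \<longleftrightarrow>
     real_analytic (\<lambda>z :: real ^ ('d + 'm). f (\<chi> i. z $ Inl i) (\<chi> j. z $ Inr j))"

definition admissible_loss :: "(real \<Rightarrow> real \<Rightarrow> real) \<Rightarrow> bool" where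
  "admissible_loss l \<longleftrightarrow>
     (\<forall>u v. l u v \<ge> 0) \<and> (\<forall>u v. l u v = 0 \<longleftrightarrow> u = v) \<and>
     (\<exists>D :: real \<times> real \<Rightarrow> real \<times> real \<Rightarrow> real.
        (\<forall>z. (case_prod l has_derivative D z) (at z)) \<and>
        (\<forall>h. continuous_on UNIV (\<lambda>z. D z h)))"

definition function_space :: "(real ^ 'd \<Rightarrow> real ^ 'm \<Rightarrow> real) \<Rightarrow> (real ^ 'd \<Rightarrow> real) set" where
  "function_space f = {(\<lambda>x. f x \<theta>) | \<theta>. True}"

definition target_set :: "(real ^ 'd \<Rightarrow> real ^ 'm \<Rightarrow> real) \<Rightarrow> (real ^ 'd \<Rightarrow> real) \<Rightarrow> (real ^ 'm) set" where
  "target_set f fstar = {\<theta>. (\<lambda>x. f x \<theta>) = fstar}"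

definition param_grad :: "(real ^ 'd \<Rightarrow> real ^ 'm \<Rightarrow> real) \<Rightarrow> real ^ 'd \<Rightarrow> real ^ 'm \<Rightarrow> real ^ 'm" where
  "param_grad f x \<theta>' = (\<chi> j. frechet_derivative (\<lambda>\<theta>. f x \<theta>) (at \<theta>') (axis j 1))"

definition tangent_hyperplane :: "(real ^ 'd \<Rightarrow> real ^ 'm \<Rightarrow> real) \<Rightarrow> real ^ 'm \<Rightarrow> (real ^ 'd \<Rightarrow> real) set" where
  "tangent_hyperplane f \<theta>' = {(\<lambda>x. f x \<theta>' + a \<bullet> param_grad f x \<theta>') | a. True}"

definition emp_loss :: "(real \<Rightarrow> real \<Rightarrow> real) \<Rightarrow> (real ^ 'd \<Rightarrow> real) \<Rightarrow> nat \<Rightarrow> (nat \<Rightarrow> real ^ 'd)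
    \<Rightarrow> (real ^ 'd \<Rightarrow> real) \<Rightarrow> real" where
  "emp_loss l fstar n X g = (if n = 0 then 0 else (1 / real n) * (\<Sum>i<n. l (g (X i)) (fstar (X i))))"

definition LLR_guarantee_from ::
  "(real ^ 'd \<Rightarrow> real ^ 'm \<Rightarrow> real) \<Rightarrow> (real \<Rightarrow> real \<Rightarrow> real) \<Rightarrow> (real ^ 'd \<Rightarrow> real)
    \<Rightarrow> nat \<Rightarrow> (nat \<Rightarrow> real ^ 'd) \<Rightarrow> bool" where
  "LLR_guarantee_from f l fstar n X \<longleftrightarrow>
     (\<exists>\<theta>' \<in> target_set f fstar.
        {g \<in> tangent_hyperplane f \<theta>'. \<forall>h \<in> tangent_hyperplane f \<theta>'.
            emp_loss l fstar n X g \<le> emp_loss l fstar n X h} = {fstar})"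

definition n_sample_LLR_guarantee ::
  "(real ^ 'd \<Rightarrow> real ^ 'm \<Rightarrow> real) \<Rightarrow> (real \<Rightarrow> real \<Rightarrow> real) \<Rightarrow> (real ^ 'd \<Rightarrow> real) \<Rightarrow> nat \<Rightarrow> bool" where
  "n_sample_LLR_guarantee f l fstar n \<longleftrightarrow> (\<exists>X. LLR_guarantee_from f l fstar n X)"

end

(* Since the loss vanishes exactly on the diagonal and fstar itself lies in the tangent hyperplane
   at theta', the minimizers are the members interpolating the data.  Hence the guarantee holds at
   theta' iff the gradients v(x_i) = param_grad f x_i theta' span the same space as all gradients
   v(x).  If this happens for one sample, then n >= r = dim span (range v).  Conversely, for any
   proper subspace of span (range v) some function a . v vanishes on it but is not identically
   zero; being analytic in x, it is nonzero almost everywhere.  So, by Fubini, almost every new sample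
   raises the dimension of the span until r is reached. *)

theory Submission
  imports Defs "HOL-Complex_Analysis.Cauchy_Integral_Formula"
begin

section \<open>Analytic functions of one real variable and their zeros\<close>

text \<open>Real analyticity on the whole line, with a radius that may depend on the centre. It is
  applied to restrictions of gradient components to coordinate lines.\<close>

definition locally_powser :: "(real \<Rightarrow> real) \<Rightarrow> bool" where
  "locally_powser h \<longleftrightarrow>
     (\<forall>t0. \<exists>r>0. \<exists>c. \<forall>t. \<bar>t - t0\<bar> < r \<longrightarrow> (\<lambda>k. c k * (t - t0) ^ k) sums h t)"

lemma locally_powser_0: "locally_powser (\<lambda>_. 0)"
  unfolding locally_powser_def
  by (intro allI exI[of _ 1] conjI exI[of _ "\<lambda>_. 0"]) auto

lemma locally_powser_add:
  assumes "locally_powser g" "locally_powser h"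
  shows "locally_powser (\<lambda>t. g t + h t)"
  unfolding locally_powser_def
proof
  fix t0
  obtain r c where 1: "r > 0" "\<And>t. \<bar>t - t0\<bar> < r \<Longrightarrow> (\<lambda>k. c k * (t - t0) ^ k) sums g t"
    using assms(1) unfolding locally_powser_def by blast
  obtain s d where 2: "s > 0" "\<And>t. \<bar>t - t0\<bar> < s \<Longrightarrow> (\<lambda>k. d k * (t - t0) ^ k) sums h t"
    using assms(2) unfolding locally_powser_def by blast
  have "(\<lambda>k. (c k + d k) * (t - t0) ^ k) sums (g t + h t)" if "\<bar>t - t0\<bar> < min r s" for t
    using sums_add[OF 1(2) 2(2), of t] that by (simp add: algebra_simps)
  then show "\<exists>r>0. \<exists>c. \<forall>t. \<bar>t - t0\<bar> < r \<longrightarrow> (\<lambda>k. c k * (t - t0) ^ k) sums (g t + h t)"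
    using 1(1) 2(1) by (intro exI[of _ "min r s"] conjI exI[of _ "\<lambda>k. c k + d k"]) auto
qed

lemma locally_powser_cmult:
  assumes "locally_powser h"
  shows "locally_powser (\<lambda>t. a * h t)"
  unfolding locally_powser_def
proof
  fix t0
  obtain r c where 1: "r > 0" "\<And>t. \<bar>t - t0\<bar> < r \<Longrightarrow> (\<lambda>k. c k * (t - t0) ^ k) sums h t"
    using assms unfolding locally_powser_def by blast
  show "\<exists>r>0. \<exists>c. \<forall>t. \<bar>t - t0\<bar> < r \<longrightarrow> (\<lambda>k. c k * (t - t0) ^ k) sums (a * h t)"
    using 1(1) sums_mult[OF 1(2), of _ a]
    by (intro exI[of _ r] conjI exI[of _ "\<lambda>k. a * c k"]) (auto simp: mult.assoc)
qed

lemma locally_powser_sum: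
  assumes "\<And>j. j \<in> J \<Longrightarrow> locally_powser (h j)"
  shows "locally_powser (\<lambda>t. \<Sum>j\<in>J. h j t)"
  using assms
  by (induction J rule: infinite_finite_induct) (auto simp: locally_powser_0 locally_powser_add)

text \<open>Zeros are isolated unless all coefficients at \<open>t0\<close> vanish: a nonzero
  coefficient keeps the series away from 0 on a punctured neighbourhood.\<close>

lemma locally_powser_dichotomy:
  assumes "locally_powser h"
  shows "(\<forall>\<^sub>F t in nhds t0. h t = 0) \<or> (\<forall>\<^sub>F t in at t0. h t \<noteq> 0)"
proof -
  obtain r c where r: "r > 0" and c: "\<And>t. \<bar>t - t0\<bar> < r \<Longrightarrow> (\<lambda>k. c k * (t - t0) ^ k) sums h t"
    using assms unfolding locally_powser_def by blast
  have h0: "h t0 = c 0"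
    using c[of t0] r powser_sums_zero[of c] by (auto intro: sums_unique2)
  have cont: "isCont h t0" if "c 0 \<noteq> 0"
  proof -
    \<comment> \<open>Convergence at \<open>r/2\<close> puts 0 strictly inside the disc of
      convergence.\<close>
    have "isCont (\<lambda>x. \<Sum>k. c k * x ^ k) 0"
      using isCont_powser[of c "r/2" 0] sums_summable[OF c[of "t0 + r/2"]] r by simp
    then have "isCont (\<lambda>t. \<Sum>k. c k * (t - t0) ^ k) t0"
      by (intro isCont_o2[where f="\<lambda>t. t - t0" and g="\<lambda>x. \<Sum>k. c k * x ^ k"]) auto
    moreover have E: "\<forall>\<^sub>F t in nhds t0. (\<Sum>k. c k * (t - t0) ^ k) = h t"
      using eventually_nhds_in_open[of "ball t0 r" t0] r
      by (auto elim!: eventually_mono simp: dist_real_def intro!: sums_unique[symmetric] c)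
    ultimately show ?thesis using isCont_cong[OF E] by blast
  qed
  \<comment> \<open>\<open>powser_0_nonzero\<close> is meant for a series vanishing at its centre
    with a nonzero coefficient of positive index, so a nonzero constant term is split off and
    handled by continuity.\<close>
  consider (a) "c 0 \<noteq> 0" | (b) "\<forall>k. c k = 0" | (c) m where "c 0 = 0" "c m \<noteq> 0" "m > 0"
    by (metis gr0I)
  then show ?thesis
  proof cases
    case a
    then have "\<forall>\<^sub>F t in at t0. h t \<noteq> 0"
      using cont h0 tendsto_imp_eventually_ne[of h "h t0" "at t0" 0] by (simp add: isCont_def)
    then show ?thesis by blast
  next
    case b
    then have "h t = 0" if "\<bar>t - t0\<bar> < r" for t
      using sums_unique2[OF c[OF that], of 0] b by simp
    then have "\<forall>\<^sub>F t in nhds t0. h t = 0"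
      using r by (auto simp: eventually_nhds_metric dist_real_def)
    then show ?thesis by blast
  next
    case (c m)
    obtain s where "s > 0" "\<And>t. t \<in> cball t0 s - {t0} \<Longrightarrow> h t \<noteq> 0"
      using powser_0_nonzero[of r t0 c h m] c h0 r \<open>\<And>t. \<bar>t - t0\<bar> < r \<Longrightarrow> _\<close> by auto
    then have "\<forall>\<^sub>F t in at t0. h t \<noteq> 0"
      by (auto simp: eventually_at intro!: exI[of _ s]) (auto simp: dist_commute less_imp_le)
    then show ?thesis by blast
  qed
qed

text \<open>Identity theorem by connectedness: the set \<open>A\<close> of points near which h
  vanishes identically is clopen and misses \<open>t1\<close>, so it is empty. All zeros are then
  isolated, and a sparse subset of the reals is countable.\<close>

lemma locally_powser_countable_zeros:
  assumes h: "locally_powser h" and "h t1 \<noteq> 0"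
  shows "countable {t. h t = 0}"
proof -
  define A where "A = {t. \<forall>\<^sub>F s in nhds t. h s = 0}"
  have "open A"
    unfolding A_def by (subst open_subopen) (auto simp: eventually_nhds)
  moreover have "closed A"
  proof -
    \<comment> \<open>At a limit point of \<open>A\<close> the second alternative of the dichotomy
      fails, so the first one puts the point into \<open>A\<close>.\<close>
    have "\<not> (\<forall>\<^sub>F t in at t0. h t \<noteq> 0)" if "t0 islimpt A" for t0
    proof
      assume "\<forall>\<^sub>F t in at t0. h t \<noteq> 0"
      then have "\<forall>\<^sub>F t in at t0. t \<notin> A"
        by (rule eventually_mono) (auto simp: A_def dest: eventually_nhds_x_imp_x)
      with that show False by (simp add: islimpt_iff_eventually)
    qed
    then show ?thesis
      unfolding closed_limpt using locally_powser_dichotomy[OF h] by (auto simp: A_def)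
  qed
  moreover have "t1 \<notin> A"
    using assms(2) by (auto simp: A_def dest: eventually_nhds_x_imp_x)
  ultimately have "A = {}"
    using clopen[of A] by auto
  then have "\<forall>\<^sub>F t in at t0. h t \<noteq> 0" for t0
    using locally_powser_dichotomy[OF h, of t0] by (auto simp: A_def)
  then have "{t. h t = 0} sparse_in UNIV"
    by (simp add: sparse_in_eventually_iff)
  from sparse_imp_countable[OF open_UNIV this] show ?thesis by simp
qed

section \<open>Null sets in product spaces\<close>

text \<open>Fubini: the measure of the exceptional set is an iterated integral with the new
  coordinate inside, and the inner integral is 0 for almost every X. Measurability of P allows the
  exceptional set to be integrated.\<close>

lemma (in product_sigma_finite) AE_PiM_insertI:
  assumes fin: "finite I" "i \<notin> I"
    and P: "{X \<in> space (Pi\<^sub>M (insert i I) M). P X} \<in> sets (Pi\<^sub>M (insert i I) M)"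
    and ae: "AE X in Pi\<^sub>M I M. AE y in M i. P (X(i := y))"
  shows "AE X in Pi\<^sub>M (insert i I) M. P X"
proof -
  let ?N = "{X \<in> space (Pi\<^sub>M (insert i I) M). \<not> P X}"
  have N: "?N \<in> sets (Pi\<^sub>M (insert i I) M)"
    using P by (rule sets.sets_Collect_neg)
  have "emeasure (Pi\<^sub>M (insert i I) M) ?N = (\<integral>\<^sup>+ X. indicator ?N X \<partial>Pi\<^sub>M (insert i I) M)"
    using N by simp
  also have "\<dots> = (\<integral>\<^sup>+ X. \<integral>\<^sup>+ y. indicator ?N (X(i := y)) \<partial>M i \<partial>Pi\<^sub>M I M)"
    using N by (intro product_nn_integral_insert fin) simp
  also have "\<dots> = (\<integral>\<^sup>+ X. 0 \<partial>Pi\<^sub>M I M)"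
  proof (rule nn_integral_cong_AE)
    show "AE X in Pi\<^sub>M I M. (\<integral>\<^sup>+ y. indicator ?N (X(i := y)) \<partial>M i) = 0"
      using ae
    proof (rule eventually_mono)
      fix X assume X: "AE y in M i. P (X(i := y))"
      from X have "AE y in M i. indicator ?N (X(i := y)) = (0 :: ennreal)"
        by eventually_elim simp
      then have "(\<integral>\<^sup>+ y. indicator ?N (X(i := y)) \<partial>M i) = (\<integral>\<^sup>+ y. 0 \<partial>M i)"
        by (rule nn_integral_cong_AE)
      then show "(\<integral>\<^sup>+ y. indicator ?N (X(i := y)) \<partial>M i) = 0" by simp
    qed
  qed
  finally have "?N \<in> null_sets (Pi\<^sub>M (insert i I) M)"
    using N by auto
  then show ?thesis
    by (rule AE_I') auto
qed

(* Fubini over the coordinates: only analyticity along coordinate lines is needed. *)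
lemma AE_lborel_nonzero_if_countable_on_lines:
  fixes g :: "'a::euclidean_space \<Rightarrow> real"
  assumes g[measurable]: "g \<in> borel_measurable borel"
    and lines: "\<And>x b t. b \<in> Basis \<Longrightarrow> g (x + t *\<^sub>R b) \<noteq> 0 \<Longrightarrow> countable {t. g (x + t *\<^sub>R b) = 0}"
    and p: "g p \<noteq> 0"
  shows "AE x in lborel. g x \<noteq> 0"
proof -
  interpret product_sigma_finite "\<lambda>_. lborel :: real measure" ..
  \<comment> \<open>\<open>S J y\<close> has coordinates y along the basis vectors in
    \<open>J\<close> and 0 along the others, so the induction on \<open>J\<close> frees one
    coordinate at a time.\<close>
  define S where "S J y = (\<Sum>b\<in>J. y b *\<^sub>R b)" for J and y :: "'a \<Rightarrow> real"
  have meas: "(\<lambda>y. q + S J y) \<in> borel_measurable (Pi\<^sub>M J (\<lambda>_. lborel))" for q J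
    unfolding S_def by measurable
  \<comment> \<open>The base point q must vary: the induction step freezes the coordinate along b at
    its good value \<open>y0 b\<close> and absorbs it into q.\<close>
  have *: "AE y in Pi\<^sub>M J (\<lambda>_. lborel). g (q + S J y) \<noteq> 0"
    if "finite J" "J \<subseteq> Basis" "g (q + S J y0) \<noteq> 0" for J q y0
    using that
  proof (induction J arbitrary: q y0)
    case empty
    then show ?case by (simp add: S_def)
  next
    case (insert b J)
    have S: "S (insert b J) y = S J y + y b *\<^sub>R b" for y
      using insert.hyps by (simp add: S_def add.commute)
    have upd: "S J (y(b := t)) = S J y" for y t
      unfolding S_def using insert.hyps by (intro sum.cong) auto
    have "AE y in Pi\<^sub>M J (\<lambda>_. lborel). g ((q + y0 b *\<^sub>R b) + S J y) \<noteq> 0"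
      using insert.prems by (intro insert.IH[of _ y0]) (auto simp: S algebra_simps)
    then have "AE y in Pi\<^sub>M J (\<lambda>_. lborel). AE t in lborel. g (q + S (insert b J) (y(b := t))) \<noteq> 0"
    proof (rule eventually_mono)
      \<comment> \<open>The line through \<open>q + S J y\<close> in direction b meets a point with
        \<open>g\<close> nonzero at parameter \<open>y0 b\<close>, so its zeros are countable and
        hence null.\<close>
      fix y assume "g ((q + y0 b *\<^sub>R b) + S J y) \<noteq> 0"
      then have "countable {t. g ((q + S J y) + t *\<^sub>R b) = 0}"
        using insert.prems by (intro lines[of b _ "y0 b"]) (auto simp: algebra_simps)
      from countable_imp_null_set_lborel[OF this]
      show "AE t in lborel. g (q + S (insert b J) (y(b := t))) \<noteq> 0"
        by (intro AE_I'[of "{t. g ((q + S J y) + t *\<^sub>R b) = 0}"]) (auto simp: S upd algebra_simps)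
    qed
    moreover have "(\<lambda>y. g (q + S (insert b J) y)) \<in> borel_measurable (Pi\<^sub>M (insert b J) (\<lambda>_. lborel))"
      (is "?g \<in> _")
      by (rule measurable_compose[OF meas]) simp
    moreover from this have "{y \<in> space (Pi\<^sub>M (insert b J) (\<lambda>_. lborel)). ?g y \<noteq> 0}
        \<in> sets (Pi\<^sub>M (insert b J) (\<lambda>_. lborel))"
      by (intro sets.sets_Collect_neg borel_measurable_eq) auto
    ultimately show ?case
      using insert.hyps by (intro AE_PiM_insertI)
  qed
  have "AE y in Pi\<^sub>M Basis (\<lambda>_. lborel). g (0 + S Basis y) \<noteq> 0"
    using p by (intro *[of Basis 0 "\<lambda>b. p \<bullet> b"]) (auto simp: S_def euclidean_representation)
  \<comment> \<open>By \<open>lborel_eq\<close>, Lebesgue measure is the image of the product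
    measure under \<open>S Basis\<close>.\<close>
  then show ?thesis
    unfolding lborel_eq[where 'a='a] by (subst AE_distr_iff) (auto simp: S_def)
qed

section \<open>Power series in several variables and their partial derivatives\<close>

lemma real_analyticE:
  assumes "real_analytic F"
  obtains r c where "r > 0"
    "\<And>z. z \<in> ball p r \<Longrightarrow> ((\<lambda>\<alpha>. c \<alpha> * (\<Prod>i\<in>UNIV. (z $ i - p $ i) ^ \<alpha> i)) has_sum F z) UNIV"
  using spec[OF assms[unfolded real_analytic_def], of p]
  by (elim exE conjE) (rule that, assumption, erule bspec)

text \<open>The multi-indices of total degree at most 1, collected in \<open>Low\<close>, give the
  affine part. Absolute summability at a single point bounds all other terms together by a multiple
  of the square of \<open>norm h\<close>.\<close>

lemma power_series_has_derivative:
  fixes F :: "real ^ 'k \<Rightarrow> real"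
  assumes "r > 0"
    and c: "\<And>z. z \<in> ball p r \<Longrightarrow> ((\<lambda>\<alpha>. c \<alpha> * (\<Prod>i\<in>UNIV. (z $ i - p $ i) ^ \<alpha> i)) has_sum F z) UNIV"
  shows "(F has_derivative (\<lambda>h. \<Sum>k\<in>UNIV. c (\<lambda>i. if i = k then 1 else 0) * h $ k)) (at p)"
proof -
  define e :: "'k \<Rightarrow> 'k \<Rightarrow> nat" where "e k = (\<lambda>i. if i = k then 1 else 0)" for k
  define mon where "mon \<alpha> h = (\<Prod>i\<in>UNIV. h i ^ \<alpha> i)" for \<alpha> :: "'k \<Rightarrow> nat" and h :: "'k \<Rightarrow> real"
  define Low where "Low = insert (\<lambda>_. 0) (range e)"
  \<comment> \<open>Chosen so that the point with all coordinates \<open>rho\<close> has l1 norm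
    below r and thus lies in the ball.\<close>
  define rho where "rho = r / (CARD('k) + 1)"
  have rho: "rho > 0" using \<open>r > 0\<close> by (simp add: rho_def)
  have inj: "inj e" by (auto simp: inj_on_def e_def fun_eq_iff split: if_splits)
  have e0: "(\<lambda>_. 0) \<notin> range e"
  proof
    assume "(\<lambda>_. 0) \<in> range e"
    then obtain k where "(\<lambda>_. 0) = e k" by blast
    from fun_cong[OF this, of k] show False by (simp add: e_def)
  qed
  have mon_e: "mon (e k) h = h k" for k h
  proof -
    have "mon (e k) h = (\<Prod>i\<in>{k}. h i ^ e k i)"
      unfolding mon_def by (rule prod.mono_neutral_right) (auto simp: e_def)
    then show ?thesis by (simp add: e_def)
  qed
  have mon_0: "mon (\<lambda>_. 0) h = 1" for h by (simp add: mon_def)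
  have c': "((\<lambda>\<alpha>. c \<alpha> * mon \<alpha> (($) h)) has_sum F (p + h)) UNIV" if "norm h < r" for h
    using c[of "p + h"] that by (simp add: mon_def dist_norm)
  have degree: "sum \<alpha> UNIV \<ge> 2" if "\<alpha> \<notin> Low" for \<alpha>
  proof (rule ccontr)
    assume "\<not> sum \<alpha> UNIV \<ge> 2"
    then consider "sum \<alpha> UNIV = 0" | "sum \<alpha> UNIV = 1" by linarith
    then show False
    proof cases
      case 1
      then have "\<alpha> = (\<lambda>_. 0)" by (auto simp: fun_eq_iff)
      with that show False by (simp add: Low_def)
    next
      case 2
      then obtain k where "\<alpha> k = 1" "\<And>i. i \<noteq> k \<Longrightarrow> \<alpha> i = 0"
        by (auto simp: sum_eq_Suc0_iff)
      then have "\<alpha> = e k" by (auto simp: fun_eq_iff e_def)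
      with that show False by (simp add: Low_def)
    qed
  qed
  have low: "(\<Sum>\<alpha>\<in>Low. c \<alpha> * mon \<alpha> h) = c (\<lambda>_. 0) + (\<Sum>k\<in>UNIV. c (e k) * h k)" for h
    unfolding Low_def using inj e0 by (simp add: sum.reindex mon_e mon_0)
  \<comment> \<open>At h = 0 only the zero multi-index survives, because
    \<open>0 ^ 0 = 1\<close>.\<close>
  have Fp: "F p = c (\<lambda>_. 0)"
  proof -
    have "((\<lambda>\<alpha>. c \<alpha> * mon \<alpha> (($) (0 :: real ^ 'k))) has_sum c (\<lambda>_. 0)) UNIV"
    proof (rule has_sum_finite_neutralI[of "{\<lambda>_. 0}"])
      fix \<alpha> :: "'k \<Rightarrow> nat" assume "\<alpha> \<in> UNIV - {\<lambda>_. 0}"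
      then obtain i where "\<alpha> i \<noteq> 0" by (auto simp: fun_eq_iff)
      then have "mon \<alpha> (($) (0 :: real ^ 'k)) = 0"
        unfolding mon_def by (intro prod_zero) (auto intro!: exI[of _ i])
      then show "c \<alpha> * mon \<alpha> (($) (0 :: real ^ 'k)) = 0" by simp
    qed (auto simp: mon_0)
    with c'[of 0] \<open>r > 0\<close> show ?thesis by (auto dest: has_sum_unique)
  qed
  define B where "B = infsum (\<lambda>\<alpha>. \<bar>c \<alpha>\<bar> * mon \<alpha> (\<lambda>_. rho)) (- Low)"
  have B: "((\<lambda>\<alpha>. \<bar>c \<alpha>\<bar> * mon \<alpha> (\<lambda>_. rho)) has_sum B) (- Low)"
  proof -
    define u :: "real ^ 'k" where "u = (\<chi> i. rho)"
    have "norm u \<le> (\<Sum>i\<in>UNIV. \<bar>u $ i\<bar>)" by (rule norm_le_l1_cart)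
    also have "\<dots> = CARD('k) * rho" using rho by (simp add: u_def)
    also have "\<dots> < r" using \<open>r > 0\<close> by (simp add: rho_def field_simps)
    finally have "(\<lambda>\<alpha>. c \<alpha> * mon \<alpha> (($) u)) summable_on UNIV"
      using c' has_sum_imp_summable by blast
    \<comment> \<open>For real families, unordered summability is the same as absolute
      summability.\<close>
    then have "(\<lambda>\<alpha>. \<bar>c \<alpha> * mon \<alpha> (\<lambda>_. rho)\<bar>) summable_on UNIV"
      by (subst (asm) summable_on_iff_abs_summable_on_real) (simp add: u_def vec_lambda_inverse)
    moreover have "\<bar>mon \<alpha> (\<lambda>_. rho)\<bar> = mon \<alpha> (\<lambda>_. rho)" for \<alpha>
      using rho by (simp add: mon_def prod_nonneg)
    ultimately have "(\<lambda>\<alpha>. \<bar>c \<alpha>\<bar> * mon \<alpha> (\<lambda>_. rho)) summable_on UNIV"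
      by (simp add: abs_mult)
    then have "(\<lambda>\<alpha>. \<bar>c \<alpha>\<bar> * mon \<alpha> (\<lambda>_. rho)) summable_on (- Low)"
      by (rule summable_on_subset) simp
    then show ?thesis unfolding B_def by (rule has_sum_infsum)
  qed
  have "rho \<le> r" using \<open>r > 0\<close> by (simp add: rho_def field_simps)
  (* terms of total degree >= 2 gain a factor (norm h / rho)^2 over their value at (rho, ..., rho) *)
  have rem: "\<bar>F (p + h) - F p - (\<Sum>k\<in>UNIV. c (e k) * h $ k)\<bar> \<le> B / rho\<^sup>2 * (norm h)\<^sup>2"
    if h: "norm h < rho" for h
  proof -
    have R: "((\<lambda>\<alpha>. c \<alpha> * mon \<alpha> (($) h)) has_sum
        (F (p + h) - (\<Sum>\<alpha>\<in>Low. c \<alpha> * mon \<alpha> (($) h)))) (- Low)"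
      unfolding Compl_eq_Diff_UNIV using h \<open>rho \<le> r\<close>
      by (intro has_sum_Diff c' has_sum_finite) (auto simp: Low_def)
    then have R': "((\<lambda>\<alpha>. - (c \<alpha> * mon \<alpha> (($) h))) has_sum
        - (F (p + h) - (\<Sum>\<alpha>\<in>Low. c \<alpha> * mon \<alpha> (($) h)))) (- Low)"
      by (simp add: has_sum_uminus)
    have M: "((\<lambda>\<alpha>. (\<bar>c \<alpha>\<bar> * mon \<alpha> (\<lambda>_. rho)) * (norm h / rho)\<^sup>2) has_sum
        B * (norm h / rho)\<^sup>2) (- Low)"
      by (rule has_sum_cmult_left[OF B])
    have le: "\<bar>c \<alpha> * mon \<alpha> (($) h)\<bar> \<le> (\<bar>c \<alpha>\<bar> * mon \<alpha> (\<lambda>_. rho)) * (norm h / rho)\<^sup>2"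
      if "\<alpha> \<in> - Low" for \<alpha>
    proof -
      have "\<bar>mon \<alpha> (($) h)\<bar> \<le> (\<Prod>i\<in>UNIV. norm h ^ \<alpha> i)"
        unfolding mon_def abs_prod power_abs
        by (intro prod_mono conjI power_mono component_le_norm_cart) auto
      also have "\<dots> = norm h ^ sum \<alpha> UNIV" by (simp add: power_sum)
      also have "\<dots> = rho ^ sum \<alpha> UNIV * (norm h / rho) ^ sum \<alpha> UNIV"
        using rho by (simp add: power_divide)
      also have "\<dots> \<le> rho ^ sum \<alpha> UNIV * (norm h / rho)\<^sup>2"
        using rho h degree[of \<alpha>] that
        by (intro mult_left_mono power_decreasing) (auto simp: field_simps)
      finally have "\<bar>mon \<alpha> (($) h)\<bar> \<le> mon \<alpha> (\<lambda>_. rho) * (norm h / rho)\<^sup>2"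
        by (simp add: mon_def power_sum)
      then have "\<bar>c \<alpha>\<bar> * \<bar>mon \<alpha> (($) h)\<bar> \<le> \<bar>c \<alpha>\<bar> * (mon \<alpha> (\<lambda>_. rho) * (norm h / rho)\<^sup>2)"
        by (intro mult_left_mono) auto
      then show ?thesis by (simp add: abs_mult mult.assoc)
    qed
    \<comment> \<open>\<open>has_sum_mono\<close> compares signed sums, so the two bounds come
      separately from the one majorant \<open>M\<close>.\<close>
    have "\<bar>F (p + h) - (\<Sum>\<alpha>\<in>Low. c \<alpha> * mon \<alpha> (($) h))\<bar> \<le> B * (norm h / rho)\<^sup>2"
    proof (rule abs_leI)
      show "F (p + h) - (\<Sum>\<alpha>\<in>Low. c \<alpha> * mon \<alpha> (($) h)) \<le> B * (norm h / rho)\<^sup>2"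
        using le by (intro has_sum_mono[OF R M]) fastforce
      show "- (F (p + h) - (\<Sum>\<alpha>\<in>Low. c \<alpha> * mon \<alpha> (($) h))) \<le> B * (norm h / rho)\<^sup>2"
        using le by (intro has_sum_mono[OF R' M]) fastforce
    qed
    then show ?thesis by (simp add: low Fp power_divide algebra_simps)
  qed
  have bl: "bounded_linear (\<lambda>h. \<Sum>k\<in>UNIV. c (e k) * h $ k)"
    by (intro bounded_linear_sum bounded_linear_const_mult bounded_linear_vec_nth)
  have "(\<lambda>h. norm (F (p + h) - F p - (\<Sum>k\<in>UNIV. c (e k) * h $ k)) / norm h) \<midarrow>0\<rightarrow> 0"
  proof (rule tendsto_0_le[where K=1 and f="\<lambda>h. B / rho\<^sup>2 * norm h"])
    show "((\<lambda>h. B / rho\<^sup>2 * norm h) \<longlongrightarrow> 0) (at (0 :: real ^ 'k))"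
      by (intro tendsto_mult_right_zero tendsto_norm_zero tendsto_ident_at)
    have "\<forall>\<^sub>F h in at (0 :: real ^ 'k). h \<noteq> 0 \<and> norm h < rho"
      using rho by (auto simp: eventually_at intro!: exI[of _ rho])
    then show "\<forall>\<^sub>F h in at 0. norm (norm (F (p + h) - F p - (\<Sum>k\<in>UNIV. c (e k) * h $ k)) / norm h)
        \<le> norm (B / rho\<^sup>2 * norm h) * 1"
    proof eventually_elim
      case (elim h)
      have "\<bar>F (p + h) - F p - (\<Sum>k\<in>UNIV. c (e k) * h $ k)\<bar> \<le> B / rho\<^sup>2 * (norm h)\<^sup>2"
        using rem elim by blast
      also have "\<dots> = (B / rho\<^sup>2 * norm h) * norm h" by (simp add: power2_eq_square)
      also have "\<dots> \<le> \<bar>B / rho\<^sup>2 * norm h\<bar> * norm h" by (intro mult_right_mono abs_ge_self) auto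
      finally show ?case using elim rho by (simp add: divide_le_eq)
    qed
  qed
  with bl show ?thesis
    unfolding has_derivative_at e_def by blast
qed

text \<open>On the plane through p spanned by two axes, every monomial involving a third coordinate
  is 0, so the series collapses to a double series. The bound \<open>r / 2\<close> on both
  parameters keeps the point in the ball by the triangle inequality.\<close>

lemma power_series_two_variables:
  fixes F :: "real ^ 'k \<Rightarrow> real"
  assumes "r > 0" and "i \<noteq> j"
    and c: "\<And>z. z \<in> ball p r \<Longrightarrow> ((\<lambda>\<alpha>. c \<alpha> * (\<Prod>m\<in>UNIV. (z $ m - p $ m) ^ \<alpha> m)) has_sum F z) UNIV"
  obtains C where "\<And>t s. \<bar>t\<bar> < r / 2 \<Longrightarrow> \<bar>s\<bar> < r / 2 \<Longrightarrow>
    ((\<lambda>(a, b). C a b * t ^ b * s ^ a) has_sum F (p + t *\<^sub>R axis i 1 + s *\<^sub>R axis j 1)) UNIV"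
proof -
  \<comment> \<open>The multi-indices supported on {i, j}. The first entry a is the power of s and
    the second entry b the power of t, so that summing over b first groups the series by powers of
    s.\<close>
  define phi :: "nat \<times> nat \<Rightarrow> 'k \<Rightarrow> nat"
    where "phi = (\<lambda>(a, b) m. if m = i then b else if m = j then a else 0)"
  have inj: "inj phi"
  proof (rule injI)
    fix x y assume "phi x = phi y"
    then have "phi x i = phi y i" "phi x j = phi y j" by simp_all
    then show "x = y" using \<open>i \<noteq> j\<close> by (auto simp: phi_def split: prod.splits)
  qed
  have range: "\<alpha> \<in> range phi" if "\<And>m. m \<noteq> i \<Longrightarrow> m \<noteq> j \<Longrightarrow> \<alpha> m = 0" for \<alpha>
    by (rule range_eqI[of _ _ "(\<alpha> j, \<alpha> i)"]) (use that \<open>i \<noteq> j\<close> in \<open>auto simp: phi_def fun_eq_iff\<close>)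
  show thesis
  proof
    fix t s :: real assume ts: "\<bar>t\<bar> < r / 2" "\<bar>s\<bar> < r / 2"
    define z where "z = t *\<^sub>R axis i 1 + s *\<^sub>R axis j (1 :: real)"
    have "norm z \<le> \<bar>t\<bar> + \<bar>s\<bar>"
      unfolding z_def by (rule norm_triangle_le) simp
    then have zr: "p + z \<in> ball p r" using ts by (simp add: dist_norm)
    have zm: "z $ m = (if m = i then t else if m = j then s else 0)" for m
      using \<open>i \<noteq> j\<close> by (simp add: z_def axis_def)
    have "((\<lambda>\<alpha>. c \<alpha> * (\<Prod>m\<in>UNIV. z $ m ^ \<alpha> m)) has_sum F (p + z)) UNIV"
      using c[OF zr] by simp
    also have "?this \<longleftrightarrow> ((\<lambda>\<alpha>. c \<alpha> * (\<Prod>m\<in>UNIV. z $ m ^ \<alpha> m)) has_sum F (p + z)) (range phi)"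
    proof (rule has_sum_cong_neutral)
      fix \<alpha> assume "\<alpha> \<in> UNIV - range phi"
      then obtain m where "m \<noteq> i" "m \<noteq> j" "\<alpha> m \<noteq> 0" using range by blast
      then have "(\<Prod>m\<in>UNIV. z $ m ^ \<alpha> m) = 0"
        by (intro prod_zero) (auto simp: zm intro!: exI[of _ m])
      then show "c \<alpha> * (\<Prod>m\<in>UNIV. z $ m ^ \<alpha> m) = 0" by simp
    qed auto
    also have "\<dots> \<longleftrightarrow> ((\<lambda>(a, b). c (phi (a, b)) * t ^ b * s ^ a) has_sum F (p + z)) UNIV"
    proof (subst has_sum_reindex[OF inj], rule has_sum_cong)
      fix ab :: "nat \<times> nat"
      obtain a b where ab: "ab = (a, b)" by fastforce
      have "(\<Prod>m\<in>UNIV. z $ m ^ phi (a, b) m) = (\<Prod>m\<in>{i, j}. z $ m ^ phi (a, b) m)"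
        by (rule prod.mono_neutral_right) (auto simp: phi_def)
      also have "\<dots> = t ^ b * s ^ a" using \<open>i \<noteq> j\<close> by (simp add: zm phi_def)
      finally show "((\<lambda>\<alpha>. c \<alpha> * (\<Prod>m\<in>UNIV. z $ m ^ \<alpha> m)) \<circ> phi) ab =
          (case ab of (a, b) \<Rightarrow> c (phi (a, b)) * t ^ b * s ^ a)"
        by (simp add: ab)
    qed
    finally show "((\<lambda>(a, b). c (phi (a, b)) * t ^ b * s ^ a) has_sum
        F (p + t *\<^sub>R axis i 1 + s *\<^sub>R axis j 1)) UNIV"
      by (simp add: z_def add.assoc)
  qed
qed

text \<open>Regrouped by powers of s, the double series has as coefficient of s a power series in t,
  and this coefficient is the partial derivative in direction j at s = 0.\<close>

lemma real_analytic_partial_locally_powser: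
  fixes F :: "real ^ 'k \<Rightarrow> real"
  assumes F: "real_analytic F" and "i \<noteq> j"
    and D: "\<And>t. ((\<lambda>s. F (q + t *\<^sub>R axis i 1 + s *\<^sub>R axis j 1)) has_real_derivative h t) (at 0)"
  shows "locally_powser h"
  unfolding locally_powser_def
proof
  fix t0
  define p where "p = q + t0 *\<^sub>R axis i 1"
  obtain r c where r: "r > 0" and rc:
    "\<And>z. z \<in> ball p r \<Longrightarrow> ((\<lambda>\<alpha>. c \<alpha> * (\<Prod>m\<in>UNIV. (z $ m - p $ m) ^ \<alpha> m)) has_sum F z) UNIV"
    by (rule real_analyticE[OF F, of p]) blast
  from power_series_two_variables[OF r \<open>i \<noteq> j\<close> rc] obtain C where C:
    "\<And>t s. \<bar>t\<bar> < r / 2 \<Longrightarrow> \<bar>s\<bar> < r / 2 \<Longrightarrow>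
      ((\<lambda>(a, b). C a b * t ^ b * s ^ a) has_sum F (p + t *\<^sub>R axis i 1 + s *\<^sub>R axis j 1)) UNIV"
    by blast
  have series: "(\<lambda>b. C 1 b * t ^ b) sums h (t0 + t)" if t: "\<bar>t\<bar> < r / 2" for t
  proof -
    \<comment> \<open>A nonzero admissible value of s: the factor \<open>K ^ a\<close> can be
      cancelled from a slice of the double series, and convergence at \<open>K\<close> justifies
      termwise differentiation at 0.\<close>
    define K where "K = r / 4"
    have K: "K > 0" "\<bar>K\<bar> < r / 2" using r by (auto simp: K_def)
    have row: "(\<lambda>b. C a b * t ^ b) summable_on UNIV" for a
    proof -
      have "(\<lambda>(a, b). C a b * t ^ b * K ^ a) summable_on (UNIV \<times> UNIV)"
        using C[OF t K(2)] by (auto intro: has_sum_imp_summable)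
      then have "(\<lambda>b. C a b * t ^ b * K ^ a) summable_on UNIV"
        by (rule summable_on_SigmaD1) simp
      then show ?thesis using K by (simp add: summable_on_cmult_left')
    qed
    define A where "A a = infsum (\<lambda>b. C a b * t ^ b) UNIV" for a
    have rowA: "((\<lambda>b. C a b * t ^ b) has_sum A a) UNIV" for a
      unfolding A_def by (rule has_sum_infsum[OF row])
    have rows: "((\<lambda>a. A a * s ^ a) has_sum F (p + t *\<^sub>R axis i 1 + s *\<^sub>R axis j 1)) UNIV"
      if s: "\<bar>s\<bar> < r / 2" for s
      by (rule has_sum_SigmaD[where f="\<lambda>(a, b). C a b * t ^ b * s ^ a" and B="\<lambda>_. UNIV"])
        (use C[OF t s] has_sum_cmult_left[OF rowA] in auto)
    have sums: "(\<lambda>a. A a * s ^ a) sums F (q + (t0 + t) *\<^sub>R axis i 1 + s *\<^sub>R axis j 1)"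
      if "\<bar>s\<bar> < r / 2" for s
      using has_sum_imp_sums[OF rows[OF that]] by (simp add: p_def algebra_simps)
    \<comment> \<open>At s = 0 the differentiated series reduces to its constant term
      \<open>diffs A 0\<close>, which is \<open>A 1\<close>.\<close>
    have "DERIV (\<lambda>s. \<Sum>a. A a * s ^ a) 0 :> (\<Sum>a. diffs A a * 0 ^ a)"
      by (rule termdiffs_strong[of _ K]) (use sums[OF K(2)] K in \<open>auto simp: sums_iff\<close>)
    then have "DERIV (\<lambda>s. \<Sum>a. A a * s ^ a) 0 :> A 1"
      by (simp add: powser_zero diffs_def)
    moreover have ev: "\<forall>\<^sub>F s in nhds 0. (\<Sum>a. A a * s ^ a) = F (q + (t0 + t) *\<^sub>R axis i 1 + s *\<^sub>R axis j 1)"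
    proof (rule eventually_mono)
      show "\<forall>\<^sub>F s in nhds 0. s \<in> ball 0 (r / 2)"
        using r by (intro eventually_nhds_in_open) auto
      show "(\<Sum>a. A a * s ^ a) = F (q + (t0 + t) *\<^sub>R axis i 1 + s *\<^sub>R axis j 1)"
        if "s \<in> ball 0 (r / 2)" for s
        using sums[of s] that by (simp add: sums_iff)
    qed
    ultimately have "DERIV (\<lambda>s. F (q + (t0 + t) *\<^sub>R axis i 1 + s *\<^sub>R axis j 1)) 0 :> A 1"
      using DERIV_cong_ev[OF refl ev refl] by blast
    then have "A 1 = h (t0 + t)"
      by (rule DERIV_unique[OF _ D])
    then show ?thesis
      using has_sum_imp_sums[OF rowA[of 1]] by simp
  qed
  have "(\<lambda>b. C 1 b * (t - t0) ^ b) sums h t" if "\<bar>t - t0\<bar> < r / 2" for t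
    using series[OF that] by simp
  then show "\<exists>r>0. \<exists>c. \<forall>t. \<bar>t - t0\<bar> < r \<longrightarrow> (\<lambda>k. c k * (t - t0) ^ k) sums h t"
    using r by (intro exI[of _ "r / 2"] conjI exI[of _ "C 1"]) auto
qed

section \<open>Gram-Schmidt vectors and spanning by random samples\<close>

(* No normalization and no independence assumption: a vanishing earlier vector contributes 0,
   because x / 0 = 0. *)
fun gram_schmidt :: "(nat \<Rightarrow> 'b::euclidean_space) \<Rightarrow> nat \<Rightarrow> 'b" where
  "gram_schmidt w k = w k - (\<Sum>j<k. (w k \<bullet> gram_schmidt w j /
     (gram_schmidt w j \<bullet> gram_schmidt w j)) *\<^sub>R gram_schmidt w j)"

declare gram_schmidt.simps [simp del]

text \<open>The recursion only looks back. Hence drawing a new sample leaves the earlier vectors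
  unchanged, as the induction over samples requires.\<close>

lemma gram_schmidt_cong:
  assumes "\<And>i. i \<le> k \<Longrightarrow> w i = w' i"
  shows "gram_schmidt w k = gram_schmidt w' k"
  using assms
proof (induction k rule: less_induct)
  case (less k)
  then have "gram_schmidt w j = gram_schmidt w' j" if "j < k" for j
    using that by auto
  then show ?case
    using less.prems by (subst (1 2) gram_schmidt.simps) simp
qed

lemma orthogonal_gram_schmidt_less:
  assumes "j < k"
  shows "gram_schmidt w k \<bullet> gram_schmidt w j = 0"
  using assms
proof (induction k arbitrary: j rule: less_induct)
  case (less k)
  let ?g = "gram_schmidt w"
  have "?g i \<bullet> ?g j = 0" if "i < k" "i \<noteq> j" for i
    using less.IH[of i j] less.IH[of j i] less.prems that
    by (cases i j rule: linorder_cases) (auto simp: inner_commute)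
  then have "(\<Sum>i<k. (w k \<bullet> ?g i / (?g i \<bullet> ?g i)) * (?g i \<bullet> ?g j)) =
      (\<Sum>i\<in>{j}. (w k \<bullet> ?g i / (?g i \<bullet> ?g i)) * (?g i \<bullet> ?g j))"
    using less.prems by (intro sum.mono_neutral_right) auto
  \<comment> \<open>If \<open>?g j\<close> is zero, both sides are 0; otherwise the quotient
    cancels.\<close>
  also have "\<dots> = w k \<bullet> ?g j" by simp
  finally show ?case
    by (subst (1) gram_schmidt.simps) (simp add: inner_diff_left inner_sum_left)
qed

lemma gram_schmidt_in_span: "gram_schmidt w k \<in> span (w ` {..k})"
proof (induction k rule: less_induct)
  case (less k)
  have "gram_schmidt w j \<in> span (w ` {..k})" if "j < k" for j
  proof -
    have "w ` {..j} \<subseteq> w ` {..k}" using that by (intro image_mono) auto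
    with less[OF that] show ?thesis using span_mono by blast
  qed
  moreover have "w k \<in> span (w ` {..k})"
    by (intro span_base) auto
  ultimately show ?case
    by (subst gram_schmidt.simps) (intro span_diff span_sum span_scale, auto)
qed

text \<open>The first \<open>dim V\<close> vectors are nonzero and pairwise orthogonal, hence
  independent; being \<open>dim V\<close> many elements of V, they form a basis of it.\<close>

lemma gram_schmidt_spans:
  fixes w :: "nat \<Rightarrow> 'b::euclidean_space"
  assumes V: "subspace V" and w: "\<And>i. i < n \<Longrightarrow> w i \<in> V" and "dim V \<le> n"
    and nz: "\<And>j. j < dim V \<Longrightarrow> gram_schmidt w j \<noteq> 0"
  shows "V \<subseteq> span (w ` {..<n})"
proof -
  let ?B = "gram_schmidt w ` {..<dim V}"
  have orth: "gram_schmidt w i \<bullet> gram_schmidt w j = 0" if "i \<noteq> j" for i j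
    using that orthogonal_gram_schmidt_less[of i j w] orthogonal_gram_schmidt_less[of j i w]
    by (cases i j rule: linorder_cases) (auto simp: inner_commute)
  have B: "?B \<subseteq> span (w ` {..<n})"
  proof clarify
    fix j assume "j < dim V"
    then have "w ` {..j} \<subseteq> w ` {..<n}" using \<open>dim V \<le> n\<close> by auto
    then show "gram_schmidt w j \<in> span (w ` {..<n})"
      using gram_schmidt_in_span[of w j] span_mono by blast
  qed
  also have sub: "\<dots> \<subseteq> V"
    using V w by (intro span_minimal) auto
  finally have BV: "?B \<subseteq> V" .
  have "pairwise orthogonal ?B"
    unfolding pairwise_def orthogonal_def by (metis imageE orth)
  then have "independent ?B"
    using nz by (intro pairwise_orthogonal_independent) auto
  \<comment> \<open>Equal vectors at distinct indices would be orthogonal to themselves, hence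
    zero.\<close>
  moreover have "inj_on (gram_schmidt w) {..<dim V}"
  proof (rule inj_onI, rule ccontr)
    fix i j assume "i \<in> {..<dim V}" "gram_schmidt w i = gram_schmidt w j" "i \<noteq> j"
    then show False using orth[of i j] nz[of i] by simp
  qed
  then have "card ?B = dim V" by (simp add: card_image)
  ultimately have "V \<subseteq> span ?B"
    using BV by (intro card_ge_dim_independent) auto
  also have "\<dots> \<subseteq> span (w ` {..<n})"
    using B by (intro span_minimal) auto
  finally show ?thesis .
qed

text \<open>The witness is the component of x orthogonal to \<open>span S\<close>; its inner product
  with x is its own squared norm.\<close>

lemma orthogonal_witness:
  fixes S :: "'b::euclidean_space set"
  assumes "x \<notin> span S"
  obtains a where "\<And>y. y \<in> S \<Longrightarrow> a \<bullet> y = 0" "a \<bullet> x \<noteq> 0"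
proof -
  obtain y z where yz: "y \<in> span S" "\<And>w. w \<in> span S \<Longrightarrow> orthogonal z w" "x = y + z"
    using orthogonal_subspace_decomp_exists[of S x] by metis
  have "z \<noteq> 0" using assms yz by auto
  moreover have "z \<bullet> y = 0" using yz by (simp add: orthogonal_def)
  ultimately have "z \<bullet> x \<noteq> 0" using yz by (simp add: inner_add_right)
  with that[of z] yz show thesis by (simp add: span_base orthogonal_def)
qed

lemma measurable_gram_schmidt:
  fixes v :: "'a::euclidean_space \<Rightarrow> 'b::euclidean_space"
  assumes [measurable]: "v \<in> borel_measurable borel" and "k < n"
  shows "(\<lambda>X. gram_schmidt (\<lambda>i. v (X i)) k) \<in> borel_measurable (Pi\<^sub>M {..<n} (\<lambda>_. lborel))"
  using assms(2)
proof (induction k rule: less_induct)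
  case (less k)
  have [measurable]: "(\<lambda>X. gram_schmidt (\<lambda>i. v (X i)) j) \<in> borel_measurable (Pi\<^sub>M {..<n} (\<lambda>_. lborel))"
    if "j \<in> {..<k}" for j
    using less that by auto
  have [measurable]: "(\<lambda>X. v (X k)) \<in> borel_measurable (Pi\<^sub>M {..<n} (\<lambda>_. lborel))"
    using less.prems by (intro measurable_compose[OF measurable_component_singleton]) auto
  show ?case
    by (subst gram_schmidt.simps) measurable
qed

(* Stated with Gram-Schmidt vectors rather than the dimension of a span because Fubini needs a
   measurable predicate. *)
lemma AE_gram_schmidt_nonzero:
  fixes v :: "'a::euclidean_space \<Rightarrow> 'b::euclidean_space"
  assumes v[measurable]: "v \<in> borel_measurable borel"
    and generic: "\<And>a x. a \<bullet> v x \<noteq> 0 \<Longrightarrow> AE x in lborel. a \<bullet> v x \<noteq> 0"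
  shows "AE X in Pi\<^sub>M {..<n} (\<lambda>_. lborel).
    \<forall>j<n. j < dim (range v) \<longrightarrow> gram_schmidt (\<lambda>i. v (X i)) j \<noteq> 0"
proof (induction n)
  case 0
  then show ?case by simp
next
  case (Suc n)
  interpret product_sigma_finite "\<lambda>_. lborel :: 'a measure" ..
  let ?P = "\<lambda>n X. \<forall>j<n. j < dim (range v) \<longrightarrow> gram_schmidt (\<lambda>i. v (X i)) j \<noteq> 0"
  have meas: "{X \<in> space (Pi\<^sub>M {..<Suc n} (\<lambda>_. lborel)). ?P (Suc n) X}
      \<in> sets (Pi\<^sub>M {..<Suc n} (\<lambda>_. lborel :: 'a measure))"
  proof (rule sets.sets_Collect_countable_All)
    show "{X \<in> space (Pi\<^sub>M {..<Suc n} (\<lambda>_. lborel)). j < Suc n \<longrightarrow> j < dim (range v) \<longrightarrow>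
        gram_schmidt (\<lambda>i. v (X i)) j \<noteq> 0} \<in> sets (Pi\<^sub>M {..<Suc n} (\<lambda>_. lborel :: 'a measure))" for j
    proof (cases "j < Suc n")
      case True
      note [measurable] = measurable_gram_schmidt[OF v True]
      show ?thesis by measurable
    qed simp
  qed
  have "AE X in Pi\<^sub>M {..<n} (\<lambda>_. lborel). AE x in lborel. ?P (Suc n) (X(n := x))"
    using Suc.IH
  proof (rule eventually_mono)
    fix X assume X: "?P n X"
    let ?S = "gram_schmidt (\<lambda>i. v (X i)) ` {..<n}"
    have same: "gram_schmidt (\<lambda>i. v ((X(n := x)) i)) j = gram_schmidt (\<lambda>i. v (X i)) j"
      if "j < n" for j x
      using that by (intro gram_schmidt_cong) auto
    show "AE x in lborel. ?P (Suc n) (X(n := x))"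
    proof (cases "n < dim (range v)")
      case False
      then have "?P (Suc n) (X(n := x))" for x
        using X same by (auto simp: less_Suc_eq)
      then show ?thesis by simp
    next
      case True
      \<comment> \<open>The n earlier vectors cannot span \<open>range v\<close>, whose dimension
        exceeds n. So some a is orthogonal to all of them but not to every value of v.\<close>
      have "dim (span ?S) \<le> card ?S"
        unfolding dim_span by (intro dim_le_card') simp
      also have "\<dots> \<le> n" using card_image_le[of "{..<n}"] by simp
      finally have "\<not> range v \<subseteq> span ?S"
        using True dim_subset[of "range v" "span ?S"] by auto
      then obtain x0 where "v x0 \<notin> span ?S" by blast
      then obtain a where a: "\<And>y. y \<in> ?S \<Longrightarrow> a \<bullet> y = 0" "a \<bullet> v x0 \<noteq> 0"
        by (rule orthogonal_witness) blast
      from generic[OF a(2)] show ?thesis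
      proof (rule eventually_mono)
        fix x assume x: "a \<bullet> v x \<noteq> 0"
        \<comment> \<open>The correction terms are multiples of earlier vectors, to which a is
          orthogonal. So the new Gram-Schmidt vector is nonzero whenever
          \<open>a \<bullet> v x\<close> is.\<close>
        have "a \<bullet> gram_schmidt (\<lambda>i. v ((X(n := x)) i)) n = a \<bullet> v x"
          by (subst gram_schmidt.simps)
            (auto simp: fun_upd_same same a(1) inner_diff_right inner_sum_right
              simp del: fun_upd_apply intro!: sum.neutral)
        with x X same show "?P (Suc n) (X(n := x))"
          by (auto simp: less_Suc_eq)
      qed
    qed
  qed
  then show ?case
    unfolding lessThan_Suc
    by (rule AE_PiM_insertI[OF finite_lessThan _ meas[unfolded lessThan_Suc], rotated]) simp
qed

lemma AE_samples_span:
  fixes v :: "'a::euclidean_space \<Rightarrow> 'b::euclidean_space"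
  assumes "v \<in> borel_measurable borel"
    and "\<And>a x. a \<bullet> v x \<noteq> 0 \<Longrightarrow> AE x in lborel. a \<bullet> v x \<noteq> 0"
    and "dim (range v) \<le> n"
  shows "AE X in Pi\<^sub>M {..<n} (\<lambda>_. lborel). range v \<subseteq> span ((\<lambda>i. v (X i)) ` {..<n})"
  using AE_gram_schmidt_nonzero[OF assms(1,2), where n=n]
proof (rule eventually_mono)
  fix X assume "\<forall>j<n. j < dim (range v) \<longrightarrow> gram_schmidt (\<lambda>i. v (X i)) j \<noteq> 0"
  then have "span (range v) \<subseteq> span ((\<lambda>i. v (X i)) ` {..<n})"
    using assms(3) by (intro gram_schmidt_spans) (auto intro: span_base)
  then show "range v \<subseteq> span ((\<lambda>i. v (X i)) ` {..<n})"
    using span_superset by blast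
qed

section \<open>The guarantee as a span condition\<close>

text \<open>For each \<theta>' separately, uniqueness of the interpolant says that every a
  orthogonal to the sampled gradients is orthogonal to all gradients. By orthogonal complements this
  is the span inclusion.\<close>

lemma LLR_guarantee_from_iff:
  fixes f :: "real ^ 'd \<Rightarrow> real ^ 'm \<Rightarrow> real"
  assumes l: "admissible_loss l"
  shows "LLR_guarantee_from f l fstar n X \<longleftrightarrow>
    (\<exists>\<theta>' \<in> target_set f fstar.
       range (\<lambda>x. param_grad f x \<theta>') \<subseteq> span ((\<lambda>i. param_grad f (X i) \<theta>') ` {..<n}))"
  unfolding LLR_guarantee_from_def
proof (rule bex_cong[OF refl])
  fix \<theta>' assume "\<theta>' \<in> target_set f fstar"
  then have fstar: "f x \<theta>' = fstar x" for x
    by (auto simp: target_set_def)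
  let ?v = "\<lambda>x. param_grad f x \<theta>'"
  let ?T = "tangent_hyperplane f \<theta>'"
  let ?W = "(\<lambda>i. ?v (X i)) ` {..<n}"
  have l0: "l u v \<ge> 0" "l u v = 0 \<longleftrightarrow> u = v" for u v
    using l by (auto simp: admissible_loss_def)
  have nonneg: "emp_loss l fstar n X g \<ge> 0" for g
    using l0 by (auto simp: emp_loss_def intro!: divide_nonneg_nonneg sum_nonneg)
  \<comment> \<open>This includes n = 0, where the loss is 0 by convention and the interpolation
    condition is vacuous.\<close>
  have zero: "emp_loss l fstar n X g = 0 \<longleftrightarrow> (\<forall>i<n. g (X i) = fstar (X i))" for g
    using l0 by (auto simp: emp_loss_def sum_nonneg_eq_0_iff)
  have T: "g \<in> ?T \<longleftrightarrow> (\<exists>a. g = (\<lambda>x. fstar x + a \<bullet> ?v x))" for g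
    by (auto simp: tangent_hyperplane_def fstar)
  have fT: "fstar \<in> ?T"
    unfolding T by (rule exI[of _ 0]) simp
  have min: "(\<forall>h\<in>?T. emp_loss l fstar n X g \<le> emp_loss l fstar n X h) \<longleftrightarrow>
      (\<forall>i<n. g (X i) = fstar (X i))" for g
  proof -
    have "emp_loss l fstar n X fstar = 0" by (simp add: zero)
    then have "(\<forall>h\<in>?T. emp_loss l fstar n X g \<le> emp_loss l fstar n X h) \<longleftrightarrow>
        emp_loss l fstar n X g = 0"
      using fT nonneg by (metis order_antisym)
    then show ?thesis by (simp add: zero)
  qed
  have "{g \<in> ?T. \<forall>h\<in>?T. emp_loss l fstar n X g \<le> emp_loss l fstar n X h} = {fstar} \<longleftrightarrow>
      (\<forall>g\<in>?T. (\<forall>i<n. g (X i) = fstar (X i)) \<longrightarrow> g = fstar)"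
    unfolding min using fT by auto
  \<comment> \<open>Different a may give the same function, so uniqueness becomes identical
    vanishing of \<open>a \<bullet> ?v x\<close>, not a = 0.\<close>
  also have "\<dots> \<longleftrightarrow> (\<forall>a. let g = \<lambda>x. fstar x + a \<bullet> ?v x in
      (\<forall>i<n. g (X i) = fstar (X i)) \<longrightarrow> g = fstar)"
    unfolding Ball_def T Let_def by blast
  also have "\<dots> \<longleftrightarrow> (\<forall>a. (\<forall>i<n. a \<bullet> ?v (X i) = 0) \<longrightarrow> (\<forall>x. a \<bullet> ?v x = 0))"
    by (simp add: fun_eq_iff)
  also have "\<dots> \<longleftrightarrow> range ?v \<subseteq> span ?W"
  proof
    assume *: "\<forall>a. (\<forall>i<n. a \<bullet> ?v (X i) = 0) \<longrightarrow> (\<forall>x. a \<bullet> ?v x = 0)"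
    show "range ?v \<subseteq> span ?W"
    proof (rule ccontr)
      assume "\<not> range ?v \<subseteq> span ?W"
      then obtain x where "?v x \<notin> span ?W" by blast
      then obtain a where "\<And>y. y \<in> ?W \<Longrightarrow> a \<bullet> y = 0" "a \<bullet> ?v x \<noteq> 0"
        by (rule orthogonal_witness) blast
      with * show False by auto
    qed
  next
    assume *: "range ?v \<subseteq> span ?W"
    show "\<forall>a. (\<forall>i<n. a \<bullet> ?v (X i) = 0) \<longrightarrow> (\<forall>x. a \<bullet> ?v x = 0)"
    proof (intro allI impI)
      fix a x assume "\<forall>i<n. a \<bullet> ?v (X i) = 0"
      then have "orthogonal a y" if "y \<in> ?W" for y
        using that by (auto simp: orthogonal_def)
      then have "orthogonal a (?v x)"
        using * by (intro orthogonal_to_span[of "?v x" ?W]) auto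
      then show "a \<bullet> ?v x = 0" by (simp add: orthogonal_def)
    qed
  qed
  finally show "({g \<in> ?T. \<forall>h\<in>?T. emp_loss l fstar n X g \<le> emp_loss l fstar n X h} = {fstar}) =
      (range ?v \<subseteq> span ?W)" .
qed

section \<open>Parameter gradients of an analytic model\<close>

text \<open>Inverse to the splitting of joint vectors in \<open>model_real_analytic\<close>: it
  turns motion in x or \<theta> into motion along \<open>Inl\<close> or \<open>Inr\<close>
  axes.\<close>

definition join :: "real ^ 'd \<Rightarrow> real ^ 'm \<Rightarrow> real ^ ('d + 'm)" where
  "join x \<theta> = (\<chi> k. case k of Inl i \<Rightarrow> x $ i | Inr j \<Rightarrow> \<theta> $ j)"

lemma bounded_linear_join: "bounded_linear (join 0)"
  by (intro linear_conv_bounded_linear[THEN iffD1] linearI)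
    (auto simp: join_def vec_eq_iff split: sum.split)

lemma join_add_axis:
  "join (x + t *\<^sub>R axis i 1) \<theta> = join x \<theta> + t *\<^sub>R axis (Inl i) 1"
  "join x (\<theta> + s *\<^sub>R axis j 1) = join x \<theta> + s *\<^sub>R axis (Inr j) 1"
  by (auto simp: join_def vec_eq_iff axis_def split: sum.split)

lemma continuous_on_join: "continuous_on UNIV (\<lambda>x. join x \<theta>)"
  unfolding join_def
proof (intro continuous_on_vec_lambda)
  show "continuous_on UNIV (\<lambda>x. case k of Inl i \<Rightarrow> x $ i | Inr j \<Rightarrow> \<theta> $ j)" for k
    by (cases k) (auto intro!: continuous_intros)
qed

context
  fixes f :: "real ^ 'd \<Rightarrow> real ^ 'm \<Rightarrow> real" and F :: "real ^ ('d + 'm) \<Rightarrow> real"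
  assumes f: "model_real_analytic f"
  defines "F \<equiv> \<lambda>z. f (\<chi> i. z $ Inl i) (\<chi> j. z $ Inr j)"
begin

lemma joint_model_analytic: "real_analytic F"
  using f unfolding model_real_analytic_def F_def .

lemma joint_model_join: "F (join x \<theta>) = f x \<theta>"
  by (simp add: F_def join_def)

lemma joint_model_differentiable: "F differentiable at p"
  by (rule real_analyticE[OF joint_model_analytic, of p])
    (rule differentiableI, rule power_series_has_derivative)

lemma model_differentiable: "(\<lambda>\<theta>. f x \<theta>) differentiable at \<theta>"
proof -
  \<comment> \<open>For fixed x the map is a translate of the linear map \<open>join 0\<close>,
    hence differentiable in \<theta>.\<close>
  have eq: "join x = (\<lambda>\<theta>. join x 0 + join 0 \<theta>)"
    by (auto simp: join_def vec_eq_iff fun_eq_iff split: sum.split)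
  have "(\<lambda>\<theta>. join x 0 + join 0 \<theta>) differentiable at \<theta>"
    using bounded_linear_imp_differentiable[OF bounded_linear_join]
    by (intro differentiable_add) auto
  then have "join x differentiable at \<theta>" by (subst eq)
  from differentiable_chain_at[OF this joint_model_differentiable]
  show ?thesis by (simp add: o_def joint_model_join)
qed

text \<open>Differentiability makes the choice in \<open>frechet_derivative\<close> the true
  derivative. This one-variable form is what the power series and the difference quotients work
  with.\<close>

lemma param_grad_DERIV:
  "((\<lambda>s. f x (\<theta> + s *\<^sub>R axis j 1)) has_real_derivative param_grad f x \<theta> $ j) (at 0)"
proof -
  let ?D = "frechet_derivative (\<lambda>\<theta>. f x \<theta>) (at \<theta>)"
  have D: "((\<lambda>\<theta>. f x \<theta>) has_derivative ?D) (at \<theta>)"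
    using model_differentiable frechet_derivative_works by blast
  then have "((\<lambda>\<theta>. f x \<theta>) has_derivative ?D) (at (\<theta> + 0 *\<^sub>R axis j 1))"
    by simp
  moreover have "((\<lambda>s. \<theta> + s *\<^sub>R axis j 1) has_derivative (\<lambda>s. s *\<^sub>R axis j (1 :: real))) (at 0)"
    by (auto intro!: derivative_eq_intros)
  ultimately have "((\<lambda>s. f x (\<theta> + s *\<^sub>R axis j 1)) has_derivative (\<lambda>s. ?D (s *\<^sub>R axis j 1))) (at 0)"
    using diff_chain_at[of "\<lambda>s. \<theta> + s *\<^sub>R axis j 1" _ 0 "\<lambda>\<theta>. f x \<theta>" ?D] by (simp add: o_def)
  moreover have "?D (s *\<^sub>R axis j 1) = param_grad f x \<theta> $ j * s" for s
    using linear_cmul[OF has_derivative_linear[OF D]] by (simp add: param_grad_def)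
  ultimately show ?thesis by (simp add: has_field_derivative_def)
qed

lemma model_borel_measurable: "(\<lambda>x. f x \<theta>) \<in> borel_measurable borel"
proof (rule borel_measurable_continuous_onI)
  have "continuous_on UNIV F"
    using joint_model_differentiable differentiable_imp_continuous_within
    by (auto simp: continuous_on_eq_continuous_within)
  from continuous_on_compose2[OF this continuous_on_join]
  show "continuous_on UNIV (\<lambda>x. f x \<theta>)" by (simp add: joint_model_join)
qed

text \<open>Each component is a pointwise limit of difference quotients that are measurable in
  x.\<close>

lemma param_grad_borel_measurable: "(\<lambda>x. param_grad f x \<theta>) \<in> borel_measurable borel"
proof -
  have "(\<lambda>x. param_grad f x \<theta> $ j) \<in> borel_measurable borel" for j
  proof (rule borel_measurable_LIMSEQ_real)
    let ?q = "\<lambda>n x. (f x (\<theta> + (1 / real (Suc n)) *\<^sub>R axis j 1) - f x \<theta>) / (1 / real (Suc n))"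
    show "(\<lambda>n. ?q n x) \<longlonglongrightarrow> param_grad f x \<theta> $ j" for x
    proof -
      have "filterlim (\<lambda>n. 1 / real (Suc n)) (at 0) sequentially"
        by (intro filterlim_atI LIMSEQ_Suc[OF lim_1_over_n]) auto
      moreover have "((\<lambda>s. (f x (\<theta> + s *\<^sub>R axis j 1) - f x \<theta>) / s) \<longlongrightarrow> param_grad f x \<theta> $ j) (at 0)"
        using param_grad_DERIV[of x \<theta> j] by (simp add: DERIV_def)
      ultimately show ?thesis by (rule filterlim_compose[rotated])
    qed
    show "?q n \<in> borel_measurable borel" for n
      using model_borel_measurable by measurable
  qed
  then show ?thesis
    by (subst borel_measurable_euclidean_space) (auto simp: Basis_vec_def inner_axis)
qed

text \<open>Along a coordinate line in x each gradient component is a local power series, and so is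
  their combination with weights a. One nonzero value on the line therefore leaves only countably
  many zeros there.\<close>

lemma AE_inner_param_grad_nonzero:
  assumes "a \<bullet> param_grad f x0 \<theta> \<noteq> 0"
  shows "AE x in lborel. a \<bullet> param_grad f x \<theta> \<noteq> 0"
proof (rule AE_lborel_nonzero_if_countable_on_lines)
  show "(\<lambda>x. a \<bullet> param_grad f x \<theta>) \<in> borel_measurable borel"
    using param_grad_borel_measurable by measurable
  fix x b :: "real ^ 'd" and t
  assume "b \<in> Basis" and nz: "a \<bullet> param_grad f (x + t *\<^sub>R b) \<theta> \<noteq> 0"
  then obtain i where b: "b = axis i 1" by (auto simp: Basis_vec_def)
  have "locally_powser (\<lambda>t. param_grad f (x + t *\<^sub>R b) \<theta> $ j)" for j
  \<comment> \<open>The line runs in a data direction \<open>Inl i\<close> and the derivative is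
    taken in a parameter direction \<open>Inr j\<close>; these axes are distinct.\<close>
  proof (rule real_analytic_partial_locally_powser[OF joint_model_analytic])
    show "((\<lambda>s. F (join x \<theta> + t *\<^sub>R axis (Inl i) 1 + s *\<^sub>R axis (Inr j) 1)) has_real_derivative
        param_grad f (x + t *\<^sub>R b) \<theta> $ j) (at 0)" for t
      using param_grad_DERIV[of "x + t *\<^sub>R b" \<theta> j] by (simp add: b joint_model_join flip: join_add_axis)
  qed simp
  then have "locally_powser (\<lambda>t. a \<bullet> param_grad f (x + t *\<^sub>R b) \<theta>)"
    unfolding inner_vec_def inner_real_def
    by (intro locally_powser_sum locally_powser_cmult)
  from locally_powser_countable_zeros[OF this nz]
  show "countable {t. a \<bullet> param_grad f (x + t *\<^sub>R b) \<theta> = 0}" .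
qed fact

end

theorem mainTheorem9:
  fixes f :: "real ^ 'd \<Rightarrow> real ^ 'm \<Rightarrow> real"
    and l :: "real \<Rightarrow> real \<Rightarrow> real"
    and fstar :: "real ^ 'd \<Rightarrow> real"
    and n :: nat
  assumes "model_real_analytic f"
    and "admissible_loss l"
    and "fstar \<in> function_space f"
    and "n_sample_LLR_guarantee f l fstar n"
  shows "AE X in PiM {..<n} (\<lambda>_. lborel). LLR_guarantee_from f l fstar n X"
proof -
  \<comment> \<open>The \<theta>' belonging to this one good sample serves for almost every other
    sample.\<close>
  obtain \<theta>' X0 where \<theta>': "\<theta>' \<in> target_set f fstar" and
    X0: "range (\<lambda>x. param_grad f x \<theta>') \<subseteq> span ((\<lambda>i. param_grad f (X0 i) \<theta>') ` {..<n})"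
    using assms(4) by (auto simp: n_sample_LLR_guarantee_def LLR_guarantee_from_iff[OF assms(2)])
  have "dim (range (\<lambda>x. param_grad f x \<theta>')) \<le> dim (span ((\<lambda>i. param_grad f (X0 i) \<theta>') ` {..<n}))"
    using X0 by (rule dim_subset)
  also have "\<dots> \<le> card ((\<lambda>i. param_grad f (X0 i) \<theta>') ` {..<n})"
    unfolding dim_span by (rule dim_le_card') simp
  also have "\<dots> \<le> n" using card_image_le[of "{..<n}"] by simp
  finally have "AE X in Pi\<^sub>M {..<n} (\<lambda>_. lborel).
      range (\<lambda>x. param_grad f x \<theta>') \<subseteq> span ((\<lambda>i. param_grad f (X i) \<theta>') ` {..<n})"
    by (intro AE_samples_span param_grad_borel_measurable[OF assms(1)]
        AE_inner_param_grad_nonzero[OF assms(1)])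
  then show ?thesis
    by (rule eventually_mono) (use \<theta>' in \<open>auto simp: LLR_guarantee_from_iff[OF assms(2)]\<close>)
qed

end
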